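(* Let $S\colon L^2(0,1)\to L^2(0,1)$ be given by $(Su)(x)=\int_0^x u(\xi)\,\mathrm{d}\xi$. Let $X:=\mathbb{R}\times L^2(0,1)$ (a Hilbert space with $\|(t,u)\|_X^2=t^2+\|u\|_{L^2(0,1)}^2$), let $$C:=\{(t,u)\in X : |u|\le t \text{ a.e. on } (0,1)\},$$ and for $h\ge 0$ let $f_h\colon X\to\mathbb{R}$, $$f_h(t,u):=t^2+\|Su\|_{L^2(0,1)}^2-\tfrac12\|u\|_{L^2(0,1)}^2-ht .$$ Then: (i) $(0,0)$ is the only local minimizer of $f_0$ on $C$, and it satisfies the second-order sufficient condition for the problem of minimizing $f_0$ over $C$, i.e., $-f_0'(0,0)\in\mathcal{N}_C(0,0)$ and there exist $\beta,\eta>0$ such that $f_0''(0,0)(t,u)^2\ge\beta\|(t,u)\|_X^2$ for all $(t,u)\in\hat C_\eta(0,0)$. (ii) For every $h>0$, the function $f_h$ does not admit any local minimizer on $C$.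
   Context: All spaces are real. A point $\bar x\in C$ is a local minimizer of $f$ on $C$ if there is $\varepsilon>0$ with $f(x)\ge f(\bar x)$ for all $x\in C$ with $\|x-\bar x\|_X\le\varepsilon$ (norm topology of $X$). For a closed convex set $C\subset X$ and $\bar x\in C$, $\mathcal{T}_C(\bar x)$ and $\mathcal{N}_C(\bar x)$ denote the tangent cone and the normal cone in the sense of convex analysis, i.e., $\mathcal{T}_C(\bar x)$ is the closure of $\{\lambda(x-\bar x): x\in C,\ \lambda\ge 0\}$ and $\mathcal{N}_C(\bar x)=\{x^\star\in X^\star : \langle x^\star,x-\bar x\rangle_X\le 0\ \ \forall x\in C\}$. For a twice continuously Fréchet differentiable $f\colon X\to\mathbb{R}$ and $\eta>0$, the approximate critical cone at $\bar x\in C$ is $\hat C_\eta(\bar x):=\{d\in\mathcal{T}_C(\bar x) : f'(\bar x)d\le\eta\|d\|_X\}$; in (i) it is taken with $f=f_0$. $f''(\bar x)d^2$ denotes the second Fréchet derivative at $\bar x$ applied to $(d,d)$. *)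

theory Defs
  imports "HOL-Analysis.Analysis"
begin

section \<open>The space of square integrable functions on the open unit interval\<close>

abbreviation unit_leb :: "real measure" where
  "unit_leb \<equiv> lebesgue_on {0<..<1}"

definition square_int :: "(real \<Rightarrow> real) \<Rightarrow> bool" where
  "square_int f \<longleftrightarrow> f \<in> borel_measurable unit_leb \<and> integrable unit_leb (\<lambda>x. (f x)\<^sup>2)"

text \<open>The values of a representative outside the interval are irrelevant.\<close>

definition ae_eq :: "(real \<Rightarrow> real) \<Rightarrow> (real \<Rightarrow> real) \<Rightarrow> bool" where
  "ae_eq f g \<longleftrightarrow> square_int f \<and> square_int g \<and> (AE x in unit_leb. f x = g x)"

interpretation unit_leb: finite_measure unit_leb
  by (rule finite_measure_lebesgue_on) simp

lemma measure_unit_leb: "measure unit_leb (space unit_leb) = 1"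
  by (simp add: measure_restrict_space)

lemma square_int_mult:
  assumes "square_int f" "square_int g"
  shows "integrable unit_leb (\<lambda>x. f x * g x)"
proof (rule Bochner_Integration.integrable_bound)
  show "integrable unit_leb (\<lambda>x. (f x)\<^sup>2 + (g x)\<^sup>2)"
    using assms by (simp add: square_int_def)
  show "(\<lambda>x. f x * g x) \<in> borel_measurable unit_leb"
    using assms by (auto simp: square_int_def intro!: borel_measurable_times)
  have "\<bar>a * b\<bar> \<le> a\<^sup>2 + b\<^sup>2" for a b :: real
  proof -
    have "0 \<le> (\<bar>a\<bar> - \<bar>b\<bar>)\<^sup>2" by simp
    then have "2 * (\<bar>a\<bar> * \<bar>b\<bar>) \<le> a\<^sup>2 + b\<^sup>2" by (simp add: power2_diff)
    moreover have "0 \<le> \<bar>a\<bar> * \<bar>b\<bar>" by simp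
    ultimately show ?thesis unfolding abs_mult by linarith
  qed
  then show "AE x in unit_leb. norm (f x * g x) \<le> norm ((f x)\<^sup>2 + (g x)\<^sup>2)"
    by simp
qed

lemma square_int_const: "square_int (\<lambda>x. c)"
  by (simp add: square_int_def)

lemma square_int_cmult: "square_int f \<Longrightarrow> square_int (\<lambda>x. c * f x)"
  by (auto simp: square_int_def power_mult_distrib intro!: borel_measurable_times)

lemma square_int_add:
  assumes "square_int f" "square_int g"
  shows "square_int (\<lambda>x. f x + g x)"
  using assms square_int_mult[OF assms]
  by (auto simp: square_int_def power2_sum mult.assoc intro!: borel_measurable_add)

lemma square_int_imp_integrable: "square_int f \<Longrightarrow> integrable unit_leb f"
  using square_int_mult[OF _ square_int_const[of 1]] by simp

lemma part_equivp_ae_eq: "part_equivp ae_eq"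
proof (rule part_equivpI)
  show "\<exists>f. ae_eq f f"
    using square_int_const by (auto simp: ae_eq_def)
  show "symp ae_eq"
    by (auto simp: symp_def ae_eq_def)
  show "transp ae_eq"
    by (auto simp: transp_def ae_eq_def)
qed

quotient_type L2 = "real \<Rightarrow> real" / partial: ae_eq
  by (rule part_equivp_ae_eq)

instantiation L2 :: real_inner
begin

lift_definition zero_L2 :: L2 is "\<lambda>x. 0"
  by (simp add: ae_eq_def square_int_const)

lift_definition plus_L2 :: "L2 \<Rightarrow> L2 \<Rightarrow> L2" is "\<lambda>f g x. f x + g x"
  by (auto simp: ae_eq_def square_int_add)

lift_definition scaleR_L2 :: "real \<Rightarrow> L2 \<Rightarrow> L2" is "\<lambda>c f x. c * f x"
  by (auto simp: ae_eq_def square_int_cmult)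

lift_definition inner_L2 :: "L2 \<Rightarrow> L2 \<Rightarrow> real" is "\<lambda>f g. \<integral>x. f x * g x \<partial>unit_leb"
proof -
  fix f f' g g'
  assume *: "ae_eq f f'" "ae_eq g g'"
  show "(\<integral>x. f x * g x \<partial>unit_leb) = (\<integral>x. f' x * g' x \<partial>unit_leb)"
  proof (rule integral_cong_AE)
    show "AE x in unit_leb. f x * g x = f' x * g' x"
      using * by (auto simp: ae_eq_def)
  qed (use * in \<open>auto simp: ae_eq_def square_int_def intro!: borel_measurable_times\<close>)
qed

definition uminus_L2 :: "L2 \<Rightarrow> L2" where "- u = (-1) *\<^sub>R u" for u :: L2
definition minus_L2 :: "L2 \<Rightarrow> L2 \<Rightarrow> L2" where "u - v = u + - v" for u v :: L2
definition norm_L2 :: "L2 \<Rightarrow> real" where "norm u = sqrt (inner u u)" for u :: L2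
definition sgn_L2 :: "L2 \<Rightarrow> L2" where "sgn u = inverse (norm u) *\<^sub>R u" for u :: L2
definition dist_L2 :: "L2 \<Rightarrow> L2 \<Rightarrow> real" where "dist u v = norm (u - v)" for u v :: L2
definition uniformity_L2 :: "(L2 \<times> L2) filter" where
  "uniformity = (INF e\<in>{0<..}. principal {(u :: L2, v). dist u v < e})"
definition open_L2 :: "L2 set \<Rightarrow> bool" where
  "open U \<longleftrightarrow> (\<forall>u\<in>U. \<forall>\<^sub>F (u', v) in uniformity. u' = u \<longrightarrow> v \<in> U)" for U :: "L2 set"

instance
proof
  fix u v w :: L2 and a b :: real and U :: "L2 set"
  show "u + v + w = u + (v + w)"
    by transfer (auto simp: ae_eq_def square_int_add add.assoc)
  show "u + v = v + u"
    by transfer (auto simp: ae_eq_def square_int_add add.commute)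
  show "0 + u = u"
    by transfer (auto simp: ae_eq_def)
  show "- u + u = 0"
    unfolding uminus_L2_def
    by transfer (auto simp: ae_eq_def square_int_const)
  show "u - v = u + - v"
    by (rule minus_L2_def)
  show "a *\<^sub>R (u + v) = a *\<^sub>R u + a *\<^sub>R v"
    by transfer (auto simp: ae_eq_def square_int_add square_int_cmult distrib_left)
  show "(a + b) *\<^sub>R u = a *\<^sub>R u + b *\<^sub>R u"
    by transfer (auto simp: ae_eq_def square_int_add square_int_cmult distrib_right)
  show "a *\<^sub>R b *\<^sub>R u = (a * b) *\<^sub>R u"
    by transfer (auto simp: ae_eq_def square_int_cmult mult.assoc)
  show "1 *\<^sub>R u = u"
    by transfer (auto simp: ae_eq_def)
  show "sgn u = inverse (norm u) *\<^sub>R u"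
    by (rule sgn_L2_def)
  show "dist u v = norm (u - v)"
    by (rule dist_L2_def)
  show "uniformity = (INF e\<in>{0<..}. principal {(u :: L2, v). dist u v < e})"
    by (rule uniformity_L2_def)
  show "open U \<longleftrightarrow> (\<forall>u\<in>U. \<forall>\<^sub>F (u', v) in uniformity. u' = u \<longrightarrow> v \<in> U)"
    by (rule open_L2_def)
  show "norm u = sqrt (inner u u)"
    by (rule norm_L2_def)
  show "inner u v = inner v u"
    by transfer (simp add: mult.commute)
  show "inner (u + v) w = inner u w + inner v w"
    by transfer (simp add: ae_eq_def distrib_right square_int_mult)
  show "inner (a *\<^sub>R u) v = a * inner u v"
    by transfer (simp add: mult.assoc)
  show "0 \<le> inner u u"
    by transfer simp
  show "inner u u = 0 \<longleftrightarrow> u = 0"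
  proof transfer
    fix f assume f: "ae_eq f f"
    then have "(\<integral>x. f x * f x \<partial>unit_leb) = 0 \<longleftrightarrow> (AE x in unit_leb. f x * f x = 0)"
      by (intro integral_nonneg_eq_0_iff_AE) (auto simp: ae_eq_def square_int_mult)
    then show "(\<integral>x. f x * f x \<partial>unit_leb) = 0 \<longleftrightarrow> ae_eq f (\<lambda>x. 0)"
      using f by (simp add: ae_eq_def square_int_const)
  qed
qed

end

lift_definition ae_bounded_by :: "L2 \<Rightarrow> real \<Rightarrow> bool"
  is "\<lambda>f t. AE x in unit_leb. \<bar>f x\<bar> \<le> t"
  by (auto simp: ae_eq_def fun_eq_iff)

section \<open>The integration operator\<close>

definition volterra_fun :: "(real \<Rightarrow> real) \<Rightarrow> real \<Rightarrow> real" where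
  "volterra_fun f x = (LINT \<xi>:{0<..<x}|lebesgue. f \<xi>)"

lemma volterra_fun_alt:
  assumes "x \<in> {0<..<1}"
  shows "volterra_fun f x = (\<integral>\<xi>. indicator {0<..<x} \<xi> * f \<xi> \<partial>unit_leb)"
proof -
  have "volterra_fun f x = (LINT \<xi>:{0<..<1}|lebesgue. indicator {0<..<x} \<xi> * f \<xi>)"
    unfolding volterra_fun_def set_lebesgue_integral_def
    using assms by (intro Bochner_Integration.integral_cong) (auto simp: indicator_def)
  also have "\<dots> = (\<integral>\<xi>. indicator {0<..<x} \<xi> * f \<xi> \<partial>unit_leb)"
    unfolding set_lebesgue_integral_def
    by (subst integral_restrict_space) auto
  finally show ?thesis .
qed

lemma integrable_indicator_unit_leb:
  assumes "integrable unit_leb f"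
  shows "integrable unit_leb (\<lambda>\<xi>. indicator {0<..<x} \<xi> * f \<xi> :: real)"
proof (rule Bochner_Integration.integrable_bound[OF assms])
  have "(\<lambda>\<xi>. indicator {0<..<x} \<xi> :: real) \<in> borel_measurable lebesgue"
    by (intro borel_measurable_indicator) simp
  then have "(\<lambda>\<xi>. indicator {0<..<x} \<xi> :: real) \<in> borel_measurable unit_leb"
    by (rule measurable_restrict_space1)
  then show "(\<lambda>\<xi>. indicator {0<..<x} \<xi> * f \<xi>) \<in> borel_measurable unit_leb"
    using assms by (intro borel_measurable_times) auto
qed (auto simp: indicator_def)

lemma volterra_fun_bound:
  assumes "integrable unit_leb f" "x \<in> {0<..<1}"
  shows "\<bar>volterra_fun f x\<bar> \<le> (\<integral>\<xi>. \<bar>f \<xi>\<bar> \<partial>unit_leb)"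
proof -
  have "\<bar>volterra_fun f x\<bar> \<le> (\<integral>\<xi>. \<bar>indicator {0<..<x} \<xi> * f \<xi>\<bar> \<partial>unit_leb)"
    unfolding volterra_fun_alt[OF assms(2)] by (rule integral_abs_bound)
  also have "\<dots> \<le> (\<integral>\<xi>. \<bar>f \<xi>\<bar> \<partial>unit_leb)"
    using assms(1) integrable_indicator_unit_leb[OF assms(1), of x]
    by (intro integral_mono integrable_abs) (auto simp: indicator_def)
  finally show ?thesis .
qed

lemma volterra_fun_measurable:
  assumes "integrable unit_leb f"
  shows "volterra_fun f \<in> borel_measurable unit_leb"
proof -
  have "continuous_on {0<..<1} (volterra_fun f)"
    unfolding continuous_on_sequentially
  proof (intro allI ballI impI)
    fix X :: "nat \<Rightarrow> real" and a
    assume a: "a \<in> {0<..<1}" and X: "(\<forall>n. X n \<in> {0<..<1}) \<and> X \<longlonglongrightarrow> a"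
    have "(\<lambda>n. \<integral>\<xi>. indicator {0<..<X n} \<xi> * f \<xi> \<partial>unit_leb)
        \<longlonglongrightarrow> (\<integral>\<xi>. indicator {0<..<a} \<xi> * f \<xi> \<partial>unit_leb)"
    proof (rule integral_dominated_convergence[where w = "\<lambda>\<xi>. \<bar>f \<xi>\<bar>"])
      have "AE \<xi> in lebesgue. \<xi> \<noteq> a"
        by (rule AE_completion) (rule AE_lborel_singleton)
      then have "AE \<xi> in unit_leb. \<xi> \<noteq> a"
        by (subst AE_restrict_space_iff) auto
      then show "AE \<xi> in unit_leb. (\<lambda>n. indicator {0<..<X n} \<xi> * f \<xi>)
          \<longlonglongrightarrow> indicator {0<..<a} \<xi> * f \<xi>"
      proof eventually_elim
        fix \<xi> assume "\<xi> \<noteq> a"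
        then consider "\<xi> < a" | "a < \<xi>" by linarith
        then have "\<forall>\<^sub>F n in sequentially. indicator {0<..<X n} \<xi> = (indicator {0<..<a} \<xi> :: real)"
        proof cases
          case 1
          then have "\<forall>\<^sub>F n in sequentially. \<xi> < X n" using X order_tendstoD(1) by blast
          then show ?thesis by eventually_elim (use 1 in \<open>auto simp: indicator_def\<close>)
        next
          case 2
          then have "\<forall>\<^sub>F n in sequentially. X n < \<xi>" using X order_tendstoD(2) by blast
          then show ?thesis by eventually_elim (use 2 in \<open>auto simp: indicator_def\<close>)
        qed
        then show "(\<lambda>n. indicator {0<..<X n} \<xi> * f \<xi>) \<longlonglongrightarrow> indicator {0<..<a} \<xi> * f \<xi>"
          by (intro tendsto_eventually) (auto elim: eventually_mono)
      qed
    qed (use assms integrable_indicator_unit_leb[OF assms] in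
          \<open>auto simp: indicator_def intro!: borel_measurable_integrable\<close>)
    then show "(volterra_fun f \<circ> X) \<longlonglongrightarrow> volterra_fun f a"
      using a X by (simp add: volterra_fun_alt o_def)
  qed
  then show ?thesis
    by (rule continuous_imp_measurable_on_sets_lebesgue) simp
qed

lemma square_int_volterra_fun:
  assumes "integrable unit_leb f"
  shows "square_int (volterra_fun f)"
  unfolding square_int_def
proof
  show *: "volterra_fun f \<in> borel_measurable unit_leb"
    by (rule volterra_fun_measurable[OF assms])
  show "integrable unit_leb (\<lambda>x. (volterra_fun f x)\<^sup>2)"
  proof (rule unit_leb.integrable_const_bound[where B = "(\<integral>\<xi>. \<bar>f \<xi>\<bar> \<partial>unit_leb)\<^sup>2"])
    show "AE x in unit_leb. norm ((volterra_fun f x)\<^sup>2) \<le> (\<integral>\<xi>. \<bar>f \<xi>\<bar> \<partial>unit_leb)\<^sup>2"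
      using volterra_fun_bound[OF assms]
      by (intro AE_I2) (auto simp: space_restrict_space simp flip: abs_le_square_iff)
    show "(\<lambda>x. (volterra_fun f x)\<^sup>2) \<in> borel_measurable unit_leb"
      by (rule borel_measurable_power[OF *])
  qed
qed

lift_definition volterra :: "L2 \<Rightarrow> L2" is volterra_fun
proof -
  fix f g assume fg: "ae_eq f g"
  then have int: "integrable unit_leb f" "integrable unit_leb g"
    by (auto simp: ae_eq_def square_int_imp_integrable)
  have "volterra_fun f x = volterra_fun g x" if "x \<in> {0<..<1}" for x
    unfolding volterra_fun_alt[OF that]
  proof (rule integral_cong_AE)
    show "AE \<xi> in unit_leb. indicator {0<..<x} \<xi> * f \<xi> = indicator {0<..<x} \<xi> * g \<xi>"
      using fg by (auto simp: ae_eq_def)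
  qed (use integrable_indicator_unit_leb int in \<open>auto intro!: borel_measurable_integrable\<close>)
  then show "ae_eq (volterra_fun f) (volterra_fun g)"
    using int by (auto simp: ae_eq_def square_int_volterra_fun space_restrict_space)
qed

lemma volterra_add: "volterra (u + v) = volterra u + volterra v"
proof transfer
  fix f g assume "ae_eq f f" "ae_eq g g"
  then have *: "integrable unit_leb f" "integrable unit_leb g" "square_int f" "square_int g"
    by (auto simp: ae_eq_def square_int_imp_integrable)
  have "volterra_fun (\<lambda>x. f x + g x) x = volterra_fun f x + volterra_fun g x"
    if "x \<in> {0<..<1}" for x
    using that * by (simp add: volterra_fun_alt distrib_left integrable_indicator_unit_leb)
  with * show "ae_eq (volterra_fun (\<lambda>x. f x + g x)) (\<lambda>x. volterra_fun f x + volterra_fun g x)"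
    by (auto simp: ae_eq_def square_int_volterra_fun square_int_add space_restrict_space)
qed

lemma volterra_scaleR: "volterra (c *\<^sub>R u) = c *\<^sub>R volterra u"
proof transfer
  fix c f assume "ae_eq f f"
  then have *: "integrable unit_leb f" "square_int f"
    by (auto simp: ae_eq_def square_int_imp_integrable)
  have "volterra_fun (\<lambda>x. c * f x) x = c * volterra_fun f x" if "x \<in> {0<..<1}" for x
    using that * by (simp add: volterra_fun_alt mult.left_commute[of _ c])
  with * show "ae_eq (volterra_fun (\<lambda>x. c * f x)) (\<lambda>x. c * volterra_fun f x)"
    by (auto simp: ae_eq_def square_int_volterra_fun square_int_cmult space_restrict_space)
qed

lemma norm_volterra_le: "norm (volterra u) \<le> norm u"
proof -
  have "inner (volterra u) (volterra u) \<le> inner u u"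
  proof transfer
    fix f assume "ae_eq f f"
    then have f: "integrable unit_leb f" "square_int f"
      by (auto simp: ae_eq_def square_int_imp_integrable)
    define c where "c = (\<integral>\<xi>. \<bar>f \<xi>\<bar> \<partial>unit_leb)"
    have f2: "integrable unit_leb (\<lambda>x. f x * f x)"
      using square_int_mult[OF f(2) f(2)] .
    have "(\<integral>x. volterra_fun f x * volterra_fun f x \<partial>unit_leb) \<le> (\<integral>x. c\<^sup>2 \<partial>unit_leb)"
    proof (rule integral_mono)
      show "integrable unit_leb (\<lambda>x. volterra_fun f x * volterra_fun f x)"
        using square_int_mult square_int_volterra_fun f(1) by blast
      fix x assume "x \<in> space unit_leb"
      then have "\<bar>volterra_fun f x\<bar> \<le> \<bar>c\<bar>"
        using volterra_fun_bound[OF f(1), of x] by (simp add: space_restrict_space c_def)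
      then show "volterra_fun f x * volterra_fun f x \<le> c\<^sup>2"
        by (simp add: abs_le_square_iff power2_eq_square)
    qed simp
    also have "\<dots> = c\<^sup>2"
      using measure_unit_leb by simp
    also have "0 \<le> (\<integral>x. (\<bar>f x\<bar> - c)\<^sup>2 \<partial>unit_leb)"
      by simp
    then have "c\<^sup>2 \<le> (\<integral>x. f x * f x \<partial>unit_leb)"
    proof -
      assume "0 \<le> (\<integral>x. (\<bar>f x\<bar> - c)\<^sup>2 \<partial>unit_leb)"
      also have "(\<integral>x. (\<bar>f x\<bar> - c)\<^sup>2 \<partial>unit_leb)
          = (\<integral>x. f x * f x + c\<^sup>2 - 2 * c * \<bar>f x\<bar> \<partial>unit_leb)"
        by (intro Bochner_Integration.integral_cong refl)
           (simp add: power2_diff mult.commute flip: power2_eq_square)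
      also have "\<dots> = (\<integral>x. f x * f x \<partial>unit_leb) + c\<^sup>2 - 2 * c * c"
        using f(1) f2 measure_unit_leb by (simp add: c_def)
      finally show ?thesis by (simp add: power2_eq_square)
    qed
    finally show "(\<integral>x. volterra_fun f x * volterra_fun f x \<partial>unit_leb)
        \<le> (\<integral>x. f x * f x \<partial>unit_leb)" .
  qed
  then show ?thesis by (simp add: norm_eq_sqrt_inner)
qed

lemma bounded_linear_volterra: "bounded_linear volterra"
  by (rule bounded_linear_intro[where K = 1])
     (simp_all add: volterra_add volterra_scaleR norm_volterra_le)

section \<open>Derivatives, cones and local minimizers\<close>

definition fderiv :: "('a::real_normed_vector \<Rightarrow> 'b::real_normed_vector) \<Rightarrow> 'a \<Rightarrow> 'a \<Rightarrow>\<^sub>L 'b" where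
  "fderiv f x = Blinfun (frechet_derivative f (at x))"

lemma fderiv_eqI: "(f has_derivative blinfun_apply D) (at x) \<Longrightarrow> fderiv f x = D"
  by (simp add: fderiv_def frechet_derivative_at[symmetric] blinfun_apply_inverse)

definition twice_cont_frechet_diff ::
    "('a::real_normed_vector \<Rightarrow> 'b::real_normed_vector) \<Rightarrow> bool" where
  "twice_cont_frechet_diff f \<longleftrightarrow>
     (\<forall>x. f differentiable (at x)) \<and> (\<forall>x. fderiv f differentiable (at x)) \<and>
     continuous_on UNIV (fderiv (fderiv f))"

definition local_minimizer_on :: "('a::real_normed_vector \<Rightarrow> real) \<Rightarrow> 'a set \<Rightarrow> 'a \<Rightarrow> bool" where
  "local_minimizer_on f C x \<longleftrightarrow>
     x \<in> C \<and> (\<exists>\<epsilon>>0. \<forall>y\<in>C. norm (y - x) \<le> \<epsilon> \<longrightarrow> f x \<le> f y)"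

definition tangent_cone :: "'a::real_normed_vector set \<Rightarrow> 'a \<Rightarrow> 'a set" where
  "tangent_cone C x = closure {r *\<^sub>R (y - x) | r y. y \<in> C \<and> 0 \<le> r}"

definition normal_cone :: "'a::real_normed_vector set \<Rightarrow> 'a \<Rightarrow> ('a \<Rightarrow>\<^sub>L real) set" where
  "normal_cone C x = {\<phi>. \<forall>y\<in>C. blinfun_apply \<phi> (y - x) \<le> 0}"

definition approx_critical_cone ::
    "('a::real_normed_vector \<Rightarrow> real) \<Rightarrow> 'a set \<Rightarrow> real \<Rightarrow> 'a \<Rightarrow> 'a set" where
  "approx_critical_cone f C \<eta> x =
     {d \<in> tangent_cone C x. blinfun_apply (fderiv f x) d \<le> \<eta> * norm d}"

definition second_order_sufficient ::
    "('a::real_normed_vector \<Rightarrow> real) \<Rightarrow> 'a set \<Rightarrow> 'a \<Rightarrow> bool" where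
  "second_order_sufficient f C x \<longleftrightarrow>
     - fderiv f x \<in> normal_cone C x \<and>
     (\<exists>\<beta>>0. \<exists>\<eta>>0. \<forall>d\<in>approx_critical_cone f C \<eta> x.
        blinfun_apply (blinfun_apply (fderiv (fderiv f) x) d) d \<ge> \<beta> * (norm d)\<^sup>2)"

section \<open>The minimization problem\<close>

text \<open>The library norm on the product type is \<open>sqrt (t\<^sup>2 + (norm u)\<^sup>2)\<close>.\<close>

definition feasible :: "(real \<times> L2) set" where
  "feasible = {(t, u). ae_bounded_by u t}"

definition objective :: "real \<Rightarrow> real \<times> L2 \<Rightarrow> real" where
  "objective h = (\<lambda>(t, u). t\<^sup>2 + (norm (volterra u))\<^sup>2 - 1 / 2 * (norm u)\<^sup>2 - h * t)"

lemma ae_bounded_by_alt: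
  "ae_bounded_by u t \<longleftrightarrow>
     (\<forall>w. square_int w \<longrightarrow> inner u (abs_L2 w) \<le> t * (\<integral>x. \<bar>w x\<bar> \<partial>unit_leb))"
proof -
  obtain f where f: "square_int f" and u: "u = abs_L2 f"
    by (induction u rule: L2.abs_induct) (auto simp: ae_eq_def)
  have inner: "inner u (abs_L2 w) = (\<integral>x. f x * w x \<partial>unit_leb)" if "square_int w" for w
    using that f unfolding u by (subst inner_L2.abs_eq) (auto simp: ae_eq_def)
  have bd: "ae_bounded_by u t \<longleftrightarrow> (AE x in unit_leb. \<bar>f x\<bar> \<le> t)"
    using f unfolding u by (subst ae_bounded_by.abs_eq) (auto simp: ae_eq_def)
  show ?thesis
  proof
    assume b: "ae_bounded_by u t"
    show "\<forall>w. square_int w \<longrightarrow> inner u (abs_L2 w) \<le> t * (\<integral>x. \<bar>w x\<bar> \<partial>unit_leb)"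
    proof (intro allI impI)
      fix w assume w: "square_int w"
      have "(\<integral>x. f x * w x \<partial>unit_leb) \<le> (\<integral>x. t * \<bar>w x\<bar> \<partial>unit_leb)"
      proof (rule integral_mono_AE)
        show "AE x in unit_leb. f x * w x \<le> t * \<bar>w x\<bar>"
          using b[unfolded bd]
        proof eventually_elim
          case (elim x)
          have "f x * w x \<le> \<bar>f x\<bar> * \<bar>w x\<bar>" by (metis abs_ge_self abs_mult)
          also have "\<dots> \<le> t * \<bar>w x\<bar>" using elim by (intro mult_right_mono) auto
          finally show ?case .
        qed
      qed (use f w in \<open>simp_all add: square_int_mult square_int_imp_integrable\<close>)
      then show "inner u (abs_L2 w) \<le> t * (\<integral>x. \<bar>w x\<bar> \<partial>unit_leb)"
        using w by (simp add: inner)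
    qed
  next
    assume *: "\<forall>w. square_int w \<longrightarrow> inner u (abs_L2 w) \<le> t * (\<integral>x. \<bar>w x\<bar> \<partial>unit_leb)"
    define w where "w x = (if \<bar>f x\<bar> \<le> t then 0 else if 0 \<le> f x then 1 else - 1 :: real)" for x
    have fm [measurable]: "f \<in> borel_measurable unit_leb"
      using f by (simp add: square_int_def)
    have wm [measurable]: "w \<in> borel_measurable unit_leb"
      unfolding w_def[abs_def] by measurable
    have w: "square_int w"
      unfolding square_int_def
    proof
      show "integrable unit_leb (\<lambda>x. (w x)\<^sup>2)"
        by (rule unit_leb.integrable_const_bound[where B = 1])
           (auto simp: w_def intro!: borel_measurable_power wm)
    qed (rule wm)
    have eq: "f x * w x - t * \<bar>w x\<bar> = max 0 (\<bar>f x\<bar> - t)" for x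
      by (auto simp: w_def)
    have nonneg: "0 \<le> f x * w x - t * \<bar>w x\<bar>" for x
      unfolding eq by simp
    have int: "integrable unit_leb (\<lambda>x. f x * w x - t * \<bar>w x\<bar>)"
      using f w by (simp add: square_int_mult square_int_imp_integrable)
    have "(\<integral>x. f x * w x - t * \<bar>w x\<bar> \<partial>unit_leb) = inner u (abs_L2 w) - t * (\<integral>x. \<bar>w x\<bar> \<partial>unit_leb)"
      using f w by (simp add: inner square_int_mult square_int_imp_integrable)
    also have "\<dots> \<le> 0" using * w by simp
    finally have "(\<integral>x. f x * w x - t * \<bar>w x\<bar> \<partial>unit_leb) = 0"
      using nonneg by (intro antisym integral_nonneg_AE) auto
    then have "AE x in unit_leb. f x * w x - t * \<bar>w x\<bar> = 0"
      using int nonneg by (subst (asm) integral_nonneg_eq_0_iff_AE) auto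
    then show "ae_bounded_by u t"
      unfolding bd by eventually_elim (simp add: eq max_def split: if_splits)
  qed
qed

lemma feasible_alt:
  "feasible = (\<Inter>w\<in>Collect square_int.
     {p. inner (snd p) (abs_L2 w) \<le> fst p * (\<integral>x. \<bar>w x\<bar> \<partial>unit_leb)})"
  by (auto simp: feasible_def ae_bounded_by_alt)

lemma closed_feasible: "closed feasible"
  unfolding feasible_alt by (intro closed_INT ballI closed_Collect_le continuous_intros)

lemma convex_feasible: "convex feasible"
  unfolding feasible_alt
proof (intro convex_INT)
  fix w
  have *: "{p. inner (snd p) (abs_L2 w) \<le> fst p * (\<integral>x. \<bar>w x\<bar> \<partial>unit_leb)}
      = {p. inner (- (\<integral>x. \<bar>w x\<bar> \<partial>unit_leb), abs_L2 w) p \<le> 0}"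
    by (auto simp: inner_prod_def inner_commute mult.commute)
  show "convex {p. inner (snd p) (abs_L2 w) \<le> fst p * (\<integral>x. \<bar>w x\<bar> \<partial>unit_leb)}"
    unfolding * by (rule convex_halfspace_le)
qed

lemma has_derivative_objective:
  "(objective h has_derivative
     (\<lambda>d. 2 * fst p * fst d + 2 * inner (volterra (snd p)) (volterra (snd d))
        - inner (snd p) (snd d) - h * fst d)) (at p)"
proof -
  have eq: "objective h = (\<lambda>p. fst p * fst p + inner (volterra (snd p)) (volterra (snd p))
      - 1 / 2 * inner (snd p) (snd p) - h * fst p)"
    by (auto simp: objective_def fun_eq_iff power2_norm_eq_inner simp flip: power2_eq_square)
  note [derivative_intros] = bounded_linear.has_derivative[OF bounded_linear_volterra]
  show ?thesis
    unfolding eq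
    by (auto intro!: derivative_eq_intros simp: inner_commute algebra_simps)
qed

lemma bounded_linear_Blinfun_bilinear:
  assumes "bounded_bilinear b"
  shows "bounded_linear (\<lambda>x. Blinfun (b x))" "blinfun_apply (Blinfun (b x)) = b x"
proof -
  interpret bounded_bilinear b by fact
  show app: "blinfun_apply (Blinfun (b x)) = b x" for x
    by (intro bounded_linear_Blinfun_apply bounded_linear_right)
  obtain K where "0 \<le> K" and K: "\<And>x y. norm (b x y) \<le> norm x * norm y * K"
    using nonneg_bounded by blast
  show "bounded_linear (\<lambda>x. Blinfun (b x))"
  proof (rule bounded_linear_intro[where K = K])
    fix x y r
    show "Blinfun (b (x + y)) = Blinfun (b x) + Blinfun (b y)"
      by (rule blinfun_eqI) (simp add: app add_left blinfun.add_left)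
    show "Blinfun (b (r *\<^sub>R x)) = r *\<^sub>R Blinfun (b x)"
      by (rule blinfun_eqI) (simp add: app scaleR_left blinfun.scaleR_left)
    show "norm (Blinfun (b x)) \<le> norm x * K"
      using K[of x] \<open>0 \<le> K\<close> by (intro norm_blinfun_bound) (simp_all add: app mult_ac)
  qed
qed

lemma twice_cont_frechet_diff_objective: "twice_cont_frechet_diff (objective h)"
proof -
  define b :: "real \<times> L2 \<Rightarrow> real \<times> L2 \<Rightarrow> real" where
    "b p d = 2 * fst p * fst d + 2 * inner (volterra (snd p)) (volterra (snd d))
       - inner (snd p) (snd d)" for p d
  define c :: "(real \<times> L2) \<Rightarrow>\<^sub>L real" where "c = Blinfun (\<lambda>d. h * fst d)"
  have c: "blinfun_apply c = (\<lambda>d. h * fst d)"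
    unfolding c_def by (intro bounded_linear_Blinfun_apply bounded_linear_intros)
  interpret V: bounded_linear volterra by (rule bounded_linear_volterra)
  have b: "bounded_bilinear b"
  proof
    show "\<exists>K. \<forall>p d. norm (b p d) \<le> norm p * norm d * K"
    proof (intro exI allI)
      fix p d :: "real \<times> L2"
      have 1: "\<bar>fst p * fst d\<bar> \<le> norm p * norm d"
        using norm_fst_le[of "fst p" "snd p"] norm_fst_le[of "fst d" "snd d"]
        by (simp add: abs_mult mult_mono)
      have 2: "norm (snd p) * norm (snd d) \<le> norm p * norm d"
        using norm_snd_le[of "snd p" "fst p"] norm_snd_le[of "snd d" "fst d"]
        by (simp add: mult_mono)
      have 3: "\<bar>inner (snd p) (snd d)\<bar> \<le> norm p * norm d"
        using Cauchy_Schwarz_ineq2[of "snd p" "snd d"] 2 by linarith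
      have "norm (volterra (snd p)) * norm (volterra (snd d)) \<le> norm (snd p) * norm (snd d)"
        by (intro mult_mono norm_volterra_le) auto
      then have 4: "\<bar>inner (volterra (snd p)) (volterra (snd d))\<bar> \<le> norm p * norm d"
        using Cauchy_Schwarz_ineq2[of "volterra (snd p)" "volterra (snd d)"] 2 by linarith
      show "norm (b p d) \<le> norm p * norm d * 5"
        unfolding b_def real_norm_def using 1 3 4 by linarith
    qed
  qed (simp_all add: b_def V.add V.scaleR inner_add_left inner_add_right algebra_simps)
  note B = bounded_linear_Blinfun_bilinear[OF b]
  let ?B = "\<lambda>p. Blinfun (b p)"
  have D1: "(objective h has_derivative blinfun_apply (?B p - c)) (at p)" for p
  proof -
    have "blinfun_apply (?B p - c) = (\<lambda>d. b p d - h * fst d)"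
      by (simp add: fun_eq_iff B(2) c blinfun.diff_left)
    then show ?thesis
      using has_derivative_objective[of h p] by (simp add: b_def)
  qed
  then have "fderiv (objective h) = (\<lambda>p. ?B p - c)"
    by (auto intro!: fderiv_eqI)
  moreover have D2: "((\<lambda>p. ?B p - c) has_derivative blinfun_apply (Blinfun ?B)) (at p)" for p
    unfolding bounded_linear_Blinfun_apply[OF B(1)]
    by (auto intro!: derivative_eq_intros bounded_linear_imp_has_derivative B(1))
  moreover from D2 have "fderiv (\<lambda>p. ?B p - c) = (\<lambda>p. Blinfun ?B)"
    by (auto intro!: fderiv_eqI)
  ultimately have eqs: "fderiv (objective h) = (\<lambda>p. ?B p - c)"
      "fderiv (fderiv (objective h)) = (\<lambda>p. Blinfun ?B)"
    by simp_all
  show ?thesis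
    unfolding twice_cont_frechet_diff_def eqs(2) unfolding eqs(1) differentiable_def
    using D1 D2 by (blast intro: continuous_on_const)
qed

text \<open>Hence \<^const>\<open>fderiv\<close>, which is arbitrary where a function is not differentiable, yields the
  genuine first and second Frechet derivatives of the objective.\<close>

end

theory Submission
  imports Defs
begin

text \<open>
  Everything that concerns \<open>f\<^sub>0\<close> at the origin rests on one estimate: a feasible \<open>(t, u)\<close> satisfies
  \<open>norm u \<le> t\<close>, because the interval has length one, so the concave term costs at most half of
  \<open>t\<^sup>2\<close> and \<open>f\<^sub>0 (t, u) \<ge> (t\<^sup>2 + (norm u)\<^sup>2) / 4\<close> (\<open>objective_ge\<close>).  Hence the origin is a global
  minimizer.  The second derivative in direction \<open>d\<close> is \<open>2 f\<^sub>0 d\<close>, since \<open>f\<^sub>0\<close> is a quadratic form,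
  and the tangent cone lies in the feasible set, which is a closed cone; so the same estimate is
  the second-order condition.

  The remaining claims follow from the fact that no \<open>(t, u)\<close> with \<open>t > 0\<close> is a local minimizer,
  whatever \<open>h\<close> is (\<open>no_local_minimizer_if_pos\<close>).  Only \<open>u\<close> is varied, with \<open>t\<close> fixed.  Negating \<open>u\<close> on
  an interval \<open>I\<close> preserves both the constraint and the norm of \<open>u\<close>, hence changes the
  objective only through \<open>(norm (S u))\<^sup>2\<close>, namely by
  \<open>- 4 \<langle>S u, S (1\<^sub>I u)\<rangle> + 4 (norm (S (1\<^sub>I u)))\<^sup>2\<close>.  When \<open>I\<close> has length \<open>1 / n\<close> with \<open>n\<close> large the negation
  is a small perturbation in \<open>L\<^sup>2\<close>, so local minimality gives
  \<open>\<langle>S u, S (1\<^sub>I u)\<rangle> \<le> (norm (S (1\<^sub>I u)))\<^sup>2 \<le> t\<^sup>2 / n\<^sup>2\<close>.  Summing over the \<open>n\<close> intervals of an equipartition yields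
  \<open>(norm (S u))\<^sup>2 \<le> t\<^sup>2 / n\<close> for all large \<open>n\<close>, thus \<open>S u = 0\<close>, and \<open>u = 0\<close> because \<open>S\<close> is injective
  (\<open>volterra_eq_0D\<close>).  But at \<open>u = 0\<close> a bump of height \<open>t\<close> on an interval of small length \<open>b\<close> wins:
  it gains \<open>t\<^sup>2 b / 2\<close> and costs only \<open>t\<^sup>2 b\<^sup>2\<close>.

  So every local minimizer has \<open>t = 0\<close> and is the origin; for \<open>h > 0\<close> the origin fails as well,
  as \<open>t\<^sup>2 - h t < 0\<close> for small \<open>t > 0\<close>.
\<close>

section \<open>Restriction to subintervals\<close>

lemma square_int_indicator_mult:
  assumes "square_int f"
  shows "square_int (\<lambda>x. indicator {a..<b} x * f x)"
  unfolding square_int_def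
proof
  have [measurable]: "f \<in> borel_measurable unit_leb"
    using assms by (simp add: square_int_def)
  have "(\<lambda>x. indicator {a..<b} x :: real) \<in> borel_measurable lebesgue"
    by (intro borel_measurable_indicator) simp
  then have [measurable]: "(\<lambda>x. indicator {a..<b} x :: real) \<in> borel_measurable unit_leb"
    by (rule measurable_restrict_space1)
  show "(\<lambda>x. indicator {a..<b} x * f x) \<in> borel_measurable unit_leb"
    by (intro borel_measurable_times) measurable
  show "integrable unit_leb (\<lambda>x. (indicator {a..<b} x * f x)\<^sup>2)"
  proof (rule Bochner_Integration.integrable_bound)
    show "integrable unit_leb (\<lambda>x. (f x)\<^sup>2)"
      using assms by (simp add: square_int_def)
    show "(\<lambda>x. (indicator {a..<b} x * f x)\<^sup>2) \<in> borel_measurable unit_leb"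
      by (intro borel_measurable_power borel_measurable_times) measurable
  qed (auto simp: indicator_def)
qed

lift_definition cut :: "real \<Rightarrow> real \<Rightarrow> L2 \<Rightarrow> L2"
  is "\<lambda>a b f x. indicator {a..<b} x * f x"
  by (auto simp: ae_eq_def square_int_indicator_mult)

lemma cut_empty: "cut a a u = 0"
  by transfer (auto simp: ae_eq_def square_int_const)

lemma cut_unit: "cut 0 1 u = u"
proof transfer
  fix f assume "ae_eq f f"
  moreover have "AE x in unit_leb. indicator {0..<1} x * f x = f x"
    by (intro AE_I2) (auto simp: space_restrict_space)
  ultimately show "ae_eq (\<lambda>x. indicator {0..<1} x * f x) f"
    by (simp add: ae_eq_def square_int_indicator_mult)
qed

lemma cut_add:
  assumes "a \<le> b" "b \<le> c"
  shows "cut a b u + cut b c u = cut a c u"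
  using assms
proof transfer
  fix a b c :: real and f
  assume "a \<le> b" "b \<le> c" "ae_eq f f"
  moreover from this have "indicator {a..<b} x * f x + indicator {b..<c} x * f x
      = indicator {a..<c} x * f x" for x
    by (auto simp: indicator_def)
  ultimately show "ae_eq (\<lambda>x. indicator {a..<b} x * f x + indicator {b..<c} x * f x)
      (\<lambda>x. indicator {a..<c} x * f x)"
    by (simp add: ae_eq_def square_int_indicator_mult)
qed

lemma sum_cut_equipartition:
  assumes "0 < n"
  shows "(\<Sum>k<n. cut (real k / real n) (real (Suc k) / real n) u) = u"
proof -
  have "(\<Sum>k<m. cut (real k / real n) (real (Suc k) / real n) u) = cut 0 (real m / real n) u" for m
    by (induction m) (simp_all add: cut_empty cut_add divide_right_mono)
  from this[of n] show ?thesis using assms by (simp add: cut_unit)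
qed

text \<open>This identity is why changing the sign of \<open>u\<close> on an interval leaves its norm unchanged: the
  cross term \<open>-4 \<langle>u, cut a b u\<rangle>\<close> cancels the quadratic one.\<close>

lemma inner_cut_right: "inner u (cut a b u) = (norm (cut a b u))\<^sup>2"
  unfolding power2_norm_eq_inner
  by transfer (auto intro!: Bochner_Integration.integral_cong simp: indicator_def)

section \<open>Functions bounded by a constant\<close>

lemma integral_indicator_interval:
  assumes "0 \<le> a" "a \<le> b" "b \<le> 1"
  shows "(\<integral>x. indicator {a..<b} x \<partial>unit_leb) = b - a"
proof -
  have "(\<integral>x. indicator {a..<b} x \<partial>unit_leb) = measure unit_leb ({a..<b} \<inter> {0<..<1})"
    by (simp add: space_restrict_space)
  also have "\<dots> = measure lebesgue ({a..<b} \<inter> {0<..<1})"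
    by (subst measure_restrict_space) auto
  also have "{a..<b} \<inter> {0<..<1} = {a..<b} - {0}"
    using assms by auto
  also have "measure lebesgue ({a..<b} - {0}) = b - a"
    using assms by (subst measure_Diff_null_set) auto
  finally show ?thesis .
qed

lemma integrable_indicator_interval: "integrable unit_leb (indicator {a..<b} :: real \<Rightarrow> real)"
  using square_int_imp_integrable[OF square_int_indicator_mult[OF square_int_const[of 1]], of a b]
  by simp

lemma power2_norm_cut_le:
  assumes "ae_bounded_by u t" "0 \<le> a" "a \<le> b" "b \<le> 1"
  shows "(norm (cut a b u))\<^sup>2 \<le> t\<^sup>2 * (b - a)"
  using assms(1) unfolding power2_norm_eq_inner
proof (transfer fixing: a b t)
  fix f assume f: "ae_eq f f" and bd: "AE x in unit_leb. \<bar>f x\<bar> \<le> t"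
  from f have s: "square_int f" by (simp add: ae_eq_def)
  have "(\<integral>x. (indicator {a..<b} x * f x) * (indicator {a..<b} x * f x) \<partial>unit_leb)
      \<le> (\<integral>x. t\<^sup>2 * indicator {a..<b} x \<partial>unit_leb)"
  proof (rule integral_mono_AE)
    show "AE x in unit_leb. (indicator {a..<b} x * f x) * (indicator {a..<b} x * f x)
        \<le> t\<^sup>2 * indicator {a..<b} x"
      using bd
    proof eventually_elim
      case (elim x)
      then have "(f x)\<^sup>2 \<le> t\<^sup>2" by (simp flip: abs_le_square_iff)
      then show ?case by (auto simp: indicator_def power2_eq_square)
    qed
  qed (use square_int_indicator_mult[OF s, of a b] integrable_indicator_interval in
      \<open>auto intro!: square_int_mult\<close>)
  also have "\<dots> = t\<^sup>2 * (b - a)"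
    using integral_indicator_interval[OF assms(2-4)] by simp
  finally show "(\<integral>x. (indicator {a..<b} x * f x) * (indicator {a..<b} x * f x) \<partial>unit_leb)
      \<le> t\<^sup>2 * (b - a)" .
qed

lemma ae_bounded_by_nonneg:
  assumes "ae_bounded_by u t"
  shows "0 \<le> t"
proof -
  have m: "integral\<^sup>L unit_leb (\<lambda>x. 1 :: real) = 1"
    using measure_unit_leb by simp
  have *: "inner u (abs_L2 w) \<le> t * (\<integral>x. \<bar>w x\<bar> \<partial>unit_leb)" if "square_int w" for w
    using assms that by (auto simp: ae_bounded_by_alt)
  have "abs_L2 (\<lambda>x. -1) = (-1) *\<^sub>R abs_L2 (\<lambda>x. 1)"
    by (subst scaleR_L2.abs_eq) (auto simp: ae_eq_def square_int_const)
  then show ?thesis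
    using *[OF square_int_const[of 1]] *[OF square_int_const[of "-1"]] m by simp
qed

lemma norm_le_bound:
  assumes "ae_bounded_by u t"
  shows "norm u \<le> t"
  by (rule power2_le_imp_le)
     (use power2_norm_cut_le[OF assms, of 0 1] ae_bounded_by_nonneg[OF assms] in
      \<open>simp_all add: cut_unit\<close>)

text \<open>Squared norms scale like the length of the interval in \<open>L\<^sup>2\<close>, but like its square after
  integration, because a primitive of the restriction is bounded by its \<open>L\<^sup>1\<close> norm.  The
  extra factor is what drives both perturbation arguments below.\<close>

lemma power2_norm_volterra_cut_le:
  assumes "ae_bounded_by u t" "0 \<le> a" "a \<le> b" "b \<le> 1"
  shows "(norm (volterra (cut a b u)))\<^sup>2 \<le> (t * (b - a))\<^sup>2"
  using assms(1) unfolding power2_norm_eq_inner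
proof (transfer fixing: a b t)
  fix f assume f: "ae_eq f f" and bd: "AE x in unit_leb. \<bar>f x\<bar> \<le> t"
  define g where "g = (\<lambda>x. indicator {a..<b} x * f x)"
  from f have g: "square_int g" by (simp add: ae_eq_def g_def square_int_indicator_mult)
  then have ig: "integrable unit_leb g" by (rule square_int_imp_integrable)
  have "(\<integral>x. \<bar>g x\<bar> \<partial>unit_leb) \<le> (\<integral>x. t * indicator {a..<b} x \<partial>unit_leb)"
  proof (rule integral_mono_AE)
    show "AE x in unit_leb. \<bar>g x\<bar> \<le> t * indicator {a..<b} x"
      using bd by eventually_elim (auto simp: g_def indicator_def)
  qed (use ig integrable_indicator_interval in auto)
  also have "\<dots> = t * (b - a)"
    using integral_indicator_interval[OF assms(2-4)] by simp
  finally have le: "(\<integral>x. \<bar>g x\<bar> \<partial>unit_leb) \<le> t * (b - a)" .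
  have "(\<integral>x. volterra_fun g x * volterra_fun g x \<partial>unit_leb)
      \<le> (\<integral>x. (t * (b - a))\<^sup>2 \<partial>unit_leb)"
  proof (rule integral_mono_AE)
    show "AE x in unit_leb. volterra_fun g x * volterra_fun g x \<le> (t * (b - a))\<^sup>2"
    proof (rule AE_I2)
      fix x assume "x \<in> space unit_leb"
      then have "\<bar>volterra_fun g x\<bar> \<le> t * (b - a)"
        using volterra_fun_bound[OF ig, of x] le by (simp add: space_restrict_space)
      then have "\<bar>volterra_fun g x\<bar>\<^sup>2 \<le> (t * (b - a))\<^sup>2"
        by (intro power_mono) auto
      then show "volterra_fun g x * volterra_fun g x \<le> (t * (b - a))\<^sup>2"
        by (simp add: power2_eq_square)
    qed
  qed (use square_int_volterra_fun[OF ig] in \<open>auto intro!: square_int_mult\<close>)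
  also have "\<dots> = (t * (b - a))\<^sup>2"
    using measure_unit_leb by simp
  finally show "(\<integral>x. volterra_fun (\<lambda>x. indicator {a..<b} x * f x) x
      * volterra_fun (\<lambda>x. indicator {a..<b} x * f x) x \<partial>unit_leb) \<le> (t * (b - a))\<^sup>2"
    by (simp add: g_def)
qed

lemma ae_bounded_by_flip:
  assumes "ae_bounded_by u t"
  shows "ae_bounded_by (u + (-2) *\<^sub>R cut a b u) t"
  using assms by transfer (auto simp: indicator_def elim!: eventually_mono)

section \<open>Injectivity of the integration operator\<close>

text \<open>The positive and the negative part of \<open>g\<close> are densities of two finite measures that agree on
  all right half-lines, hence coincide.\<close>

lemma AE_zero_if_halfline_integrals_zero:
  fixes g :: "real \<Rightarrow> real"
  assumes g: "integrable lborel g"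
    and zero: "\<And>x. (\<integral>y. indicator {x<..} y * g y \<partial>lborel) = 0"
  shows "AE x in lborel. g x = 0"
proof -
  have [measurable]: "g \<in> borel_measurable borel"
    using borel_measurable_integrable[OF g] by simp
  have int: "integrable lborel (\<lambda>y. indicator A y * h y)"
    if "integrable lborel h" "A \<in> sets borel" for A and h :: "real \<Rightarrow> real"
    using integrable_mult_indicator[of A lborel h] that by simp
  have em: "emeasure (density lborel (\<lambda>y. ennreal (h y))) A
      = ennreal (\<integral>y. indicator A y * h y \<partial>lborel)"
    if "integrable lborel h" "\<And>y. 0 \<le> h y" "A \<in> sets borel" for A and h :: "real \<Rightarrow> real"
  proof -
    have [measurable]: "h \<in> borel_measurable borel"
      using borel_measurable_integrable[OF that(1)] by simp
    have "emeasure (density lborel (\<lambda>y. ennreal (h y))) A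
        = (\<integral>\<^sup>+y. ennreal (indicator A y * h y) \<partial>lborel)"
      using that by (subst emeasure_density)
        (auto intro!: nn_integral_cong simp: indicator_def)
    also have "\<dots> = ennreal (\<integral>y. indicator A y * h y \<partial>lborel)"
      using that int by (intro nn_integral_eq_integral) auto
    finally show ?thesis .
  qed
  define p where "p y = max 0 (g y)" for y
  define q where "q y = max 0 (- g y)" for y
  have [measurable]: "p \<in> borel_measurable borel" "q \<in> borel_measurable borel"
    unfolding p_def[abs_def] q_def[abs_def] by measurable
  have p: "integrable lborel p" "\<And>y. 0 \<le> p y" and q: "integrable lborel q" "\<And>y. 0 \<le> q y"
    using g by (auto simp: p_def[abs_def] q_def[abs_def] intro!: integrable_max)
  have "density lborel (\<lambda>y. ennreal (p y)) = density lborel (\<lambda>y. ennreal (q y))"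
  proof (rule measure_eqI_lessThan)
    fix x :: real
    have "(\<integral>y. indicator {x<..} y * p y \<partial>lborel) - (\<integral>y. indicator {x<..} y * q y \<partial>lborel)
        = (\<integral>y. indicator {x<..} y * p y - indicator {x<..} y * q y \<partial>lborel)"
      using int[OF p(1)] int[OF q(1)] by (intro Bochner_Integration.integral_diff[symmetric]) auto
    also have "\<dots> = (\<integral>y. indicator {x<..} y * g y \<partial>lborel)"
      by (intro Bochner_Integration.integral_cong) (auto simp: p_def q_def indicator_def max_def)
    finally have "(\<integral>y. indicator {x<..} y * p y \<partial>lborel)
        = (\<integral>y. indicator {x<..} y * q y \<partial>lborel)"
      using zero by simp
    then show "emeasure (density lborel (\<lambda>y. ennreal (p y))) {x<..}
        = emeasure (density lborel (\<lambda>y. ennreal (q y))) {x<..}"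
      by (simp add: em[OF p] em[OF q])
    show "emeasure (density lborel (\<lambda>y. ennreal (p y))) {x<..} < \<infinity>"
      by (simp add: em[OF p])
  qed auto
  then have "AE x in lborel. ennreal (p x) = ennreal (q x)"
    by (intro sigma_finite_measure.density_unique[OF sigma_finite_lborel]) auto
  then show ?thesis
    by eventually_elim (auto simp: p_def q_def max_def split: if_splits)
qed

text \<open>The primitive is continuous, so it vanishes on the whole closed interval once it vanishes
  almost everywhere; then \<open>f\<close>, extended by zero, has vanishing integral over every half-line.
  The extension has to be replaced by a Borel representative before measures on the Borel sets
  can be compared.\<close>

lemma AE_zero_if_volterra_fun_AE_zero:
  assumes f: "integrable unit_leb f" and zero: "AE x in unit_leb. volterra_fun f x = 0"
  shows "AE x in unit_leb. f x = 0"
proof -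
  define h where "h x = indicator {0<..<1} x * f x" for x
  have h: "integrable lebesgue h"
    using f by (subst (asm) integrable_restrict_space) (auto simp: h_def[abs_def])
  then have hi: "h integrable_on {0..1}"
    using integrable_on_lebesgue integrable_on_subcbox[of h UNIV 0 1] by auto
  have eq: "volterra_fun f x = integral {0..x} h" if "x \<in> {0<..<1}" for x
  proof -
    have "volterra_fun f x = (LINT \<xi>:{0<..<x}|lebesgue. h \<xi>)"
      unfolding volterra_fun_def set_lebesgue_integral_def using that
      by (intro Bochner_Integration.integral_cong) (auto simp: h_def indicator_def)
    also have "\<dots> = integral {0<..<x} h"
      using h integrable_mult_indicator[of "{0<..<x}" lebesgue h]
      by (intro set_lebesgue_integral_eq_integral(2)) (auto simp: set_integrable_def)
    finally show ?thesis by (simp add: integral_open_interval_real)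
  qed
  define C where "C = {x \<in> {0..1}. integral {0..x} h = 0}"
  have "closed C"
    unfolding C_def using indefinite_integral_continuous_1[OF hi]
    by (intro continuous_closed_preimage_constant) auto
  moreover have "AE x\<in>{0<..<1} in lebesgue. x \<in> C"
    using zero by (subst (asm) AE_restrict_space_iff) (auto simp: C_def eq)
  ultimately have C: "x \<in> C" if "x \<in> {0<..<1}" for x
    using mem_closed_if_AE_lebesgue_open[of "{0<..<1}" C x] that by auto
  have int0: "integral {0..x} h = 0" if "x \<in> {0..1}" for x
  proof -
    have "{0<..<1} \<subseteq> C" using C by blast
    then have "{0..1} \<subseteq> C"
      using closure_minimal[of "{0<..<1}" C] \<open>closed C\<close> by simp
    with that show ?thesis by (auto simp: C_def)
  qed
  obtain g where g: "g \<in> borel_measurable lborel" and ae: "AE x in lborel. h x = g x"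
    using completion_ex_borel_measurable_real[of h lborel] borel_measurable_integrable[OF h]
    by auto
  have ae': "AE x in lebesgue. h x = g x" by (rule AE_completion[OF ae])
  have mg: "g \<in> borel_measurable lebesgue" using g by (rule measurable_completion)
  have "integrable lebesgue g"
    using integrable_cong_AE[OF borel_measurable_integrable[OF h] mg ae'] h by simp
  then have gi: "integrable lborel g" using g by (simp add: integrable_completion)
  have "AE x in lborel. g x = 0"
  proof (rule AE_zero_if_halfline_integrals_zero[OF gi])
    fix x :: real
    have ih: "integrable lebesgue (\<lambda>y. indicator {x<..} y * h y)"
      using integrable_mult_indicator[of "{x<..}" lebesgue h] h by simp
    have "(\<integral>y. indicator {x<..} y * g y \<partial>lborel) = (\<integral>y. indicator {x<..} y * g y \<partial>lebesgue)"
      using g by (subst integral_completion) auto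
    also have "\<dots> = (\<integral>y. indicator {x<..} y * h y \<partial>lebesgue)"
    proof (rule integral_cong_AE)
      show "(\<lambda>y. indicator {x<..} y * g y) \<in> borel_measurable lebesgue"
        using mg by (intro borel_measurable_times borel_measurable_indicator) auto
      show "AE y in lebesgue. indicator {x<..} y * g y = indicator {x<..} y * h y"
        using ae' by eventually_elim simp
    qed (use ih in auto)
    also have "\<dots> = (LINT y:{max 0 (min 1 x)..1}|lebesgue. h y)"
    proof -
      have "AE y in lebesgue. y \<noteq> max 0 (min 1 x)"
        by (rule AE_completion) (rule AE_lborel_singleton)
      then have *: "AE y in lebesgue. indicator {x<..} y * h y = indicator {max 0 (min 1 x)..1} y *\<^sub>R h y"
        by eventually_elim (auto simp: h_def indicator_def max_def min_def split: if_splits)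
      show ?thesis
        unfolding set_lebesgue_integral_def
        using h integrable_mult_indicator[of "{max 0 (min 1 x)..1}" lebesgue h] ih *
        by (intro integral_cong_AE) auto
    qed
    also have "\<dots> = integral {max 0 (min 1 x)..1} h"
      using h integrable_mult_indicator[of "{max 0 (min 1 x)..1}" lebesgue h]
      by (intro set_lebesgue_integral_eq_integral(2)) (auto simp: set_integrable_def)
    also have "\<dots> = integral {0..1} h - integral {0..max 0 (min 1 x)} h"
      using Henstock_Kurzweil_Integration.integral_combine[of 0 "max 0 (min 1 x)" 1 h] hi by simp
    also have "\<dots> = 0" by (simp add: int0)
    finally show "(\<integral>y. indicator {x<..} y * g y \<partial>lborel) = 0" .
  qed
  then have "AE x in lebesgue. g x = 0" by (rule AE_completion)
  with ae' have "AE x in lebesgue. h x = 0" by eventually_elim simp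
  then show ?thesis
    by (subst AE_restrict_space_iff) (auto simp: h_def elim!: eventually_mono)
qed

lemma volterra_eq_0D: "volterra u = 0 \<Longrightarrow> u = 0"
  by transfer (simp add: ae_eq_def square_int_const square_int_imp_integrable
      AE_zero_if_volterra_fun_AE_zero)

section \<open>Local minimizers\<close>

text \<open>Flipping signs on one interval of an equipartition bounds one summand of
  \<open>(norm (S u))\<^sup>2 = (\<Sum>k<n. \<langle>S u, S (c k)\<rangle>)\<close>.  Each bound is of order \<open>1 / n\<^sup>2\<close>, while there are only \<open>n\<close>
  summands.\<close>

lemma volterra_zero_if_flips_do_not_decrease:
  assumes bd: "ae_bounded_by u t" and "0 < \<epsilon>"
    and min: "\<And>w. ae_bounded_by w t \<Longrightarrow> norm w = norm u \<Longrightarrow> norm (w - u) \<le> \<epsilon> \<Longrightarrow>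
      (norm (volterra u))\<^sup>2 \<le> (norm (volterra w))\<^sup>2"
  shows "volterra u = 0"
proof -
  interpret V: bounded_linear volterra by (rule bounded_linear_volterra)
  \<comment> \<open>A flip moves \<open>u\<close> by at most \<open>2 t / sqrt n\<close>, which has to stay within \<open>\<epsilon>\<close>.\<close>
  obtain N :: nat where N: "4 * t\<^sup>2 / \<epsilon>\<^sup>2 < real N" using reals_Archimedean2 by blast
  have "real n * (norm (volterra u))\<^sup>2 \<le> t\<^sup>2" if n: "N < n" for n
  proof -
    define c where "c k = cut (real k / real n) (real (Suc k) / real n) u" for k
    have 1: "inner (volterra u) (volterra (c k)) \<le> t\<^sup>2 / (real n)\<^sup>2" if k: "k < n" for k
    proof -
      let ?w = "u + (-2) *\<^sub>R c k"
      have iv: "0 \<le> real k / real n" "real k / real n \<le> real (Suc k) / real n"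
        "real (Suc k) / real n \<le> 1" "real (Suc k) / real n - real k / real n = 1 / real n"
        using k by (auto simp: field_simps)
      have nc: "(norm (c k))\<^sup>2 \<le> t\<^sup>2 / real n"
        using power2_norm_cut_le[OF bd iv(1-3)] unfolding iv(4) by (simp add: c_def)
      have "4 * t\<^sup>2 / \<epsilon>\<^sup>2 < real n" using N n by simp
      then have "4 * (t\<^sup>2 / real n) \<le> \<epsilon>\<^sup>2"
        using \<open>0 < \<epsilon>\<close> n by (simp add: field_simps)
      then have "(norm (?w - u))\<^sup>2 \<le> \<epsilon>\<^sup>2"
        using nc by (simp add: power_mult_distrib)
      then have "norm (?w - u) \<le> \<epsilon>"
        by (rule power2_le_imp_le) (use \<open>0 < \<epsilon>\<close> in simp)
      moreover have "(norm ?w)\<^sup>2 = (norm u)\<^sup>2"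
        using inner_cut_right[of u "real k / real n" "real (Suc k) / real n"]
        unfolding c_def power2_norm_eq_inner
        by (simp add: inner_diff_left inner_diff_right inner_commute)
      then have "norm ?w = norm u" by simp
      moreover have "ae_bounded_by ?w t" unfolding c_def by (rule ae_bounded_by_flip[OF bd])
      ultimately have "(norm (volterra u))\<^sup>2 \<le> (norm (volterra ?w))\<^sup>2" by (intro min)
      also have "\<dots> = (norm (volterra u))\<^sup>2 - 4 * inner (volterra u) (volterra (c k))
          + 4 * (norm (volterra (c k)))\<^sup>2"
        unfolding power2_norm_eq_inner V.add V.scaleR
        by (simp add: inner_diff_left inner_diff_right inner_commute)
      finally have "inner (volterra u) (volterra (c k)) \<le> (norm (volterra (c k)))\<^sup>2" by simp
      also have "\<dots> \<le> (t * (1 / real n))\<^sup>2"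
        using power2_norm_volterra_cut_le[OF bd iv(1-3)] unfolding iv(4) by (simp add: c_def)
      finally show ?thesis by (simp add: power_divide)
    qed
    have "(norm (volterra u))\<^sup>2 = inner (volterra u) (volterra (\<Sum>k<n. c k))"
      using n by (simp add: c_def sum_cut_equipartition power2_norm_eq_inner del: of_nat_Suc)
    also have "\<dots> = (\<Sum>k<n. inner (volterra u) (volterra (c k)))"
      by (simp add: V.sum inner_sum_right)
    also have "\<dots> \<le> (\<Sum>k<n. t\<^sup>2 / (real n)\<^sup>2)" by (intro sum_mono 1) auto
    also have "\<dots> = t\<^sup>2 / real n" by (simp add: power2_eq_square)
    finally show ?thesis using n by (simp add: field_simps)
  qed
  note bound = this
  show ?thesis
  proof (rule ccontr)
    assume "volterra u \<noteq> 0"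
    then have pos: "0 < (norm (volterra u))\<^sup>2" by simp
    obtain m :: nat where m: "t\<^sup>2 / (norm (volterra u))\<^sup>2 < real m" using reals_Archimedean2 by blast
    let ?n = "Suc (max N m)"
    have "t\<^sup>2 < real m * (norm (volterra u))\<^sup>2" using m pos by (simp add: field_simps)
    also have "\<dots> \<le> real ?n * (norm (volterra u))\<^sup>2" by (intro mult_right_mono) auto
    also have "\<dots> \<le> t\<^sup>2" by (rule bound) simp
    finally show False by simp
  qed
qed

text \<open>The bump of height \<open>t\<close> on \<open>[0, b)\<close>: here \<open>b \<le> 1 / 3\<close> makes \<open>t\<^sup>2 b\<^sup>2\<close> smaller than \<open>t\<^sup>2 b / 2\<close>,
  and \<open>b \<le> \<epsilon>\<^sup>2 / t\<^sup>2\<close> keeps the bump small.\<close>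

lemma exists_small_decrease_at_zero:
  assumes "0 < t" "0 < \<epsilon>"
  shows "\<exists>w. ae_bounded_by w t \<and> norm w \<le> \<epsilon> \<and>
    (norm (volterra w))\<^sup>2 < 1 / 2 * (norm w)\<^sup>2"
proof -
  define b where "b = min (1 / 3) (\<epsilon>\<^sup>2 / t\<^sup>2)"
  have b: "0 < b" "b \<le> 1 / 3" "t\<^sup>2 * b \<le> \<epsilon>\<^sup>2"
    using assms by (auto simp: b_def min_def field_simps)
  define c where "c = abs_L2 (\<lambda>x. t)"
  define w where "w = cut 0 b c"
  have "ae_eq (\<lambda>x. t) (\<lambda>x. t)" by (simp add: ae_eq_def square_int_const)
  then have c: "ae_bounded_by c t"
    using assms unfolding c_def by (subst ae_bounded_by.abs_eq) auto
  have "ae_bounded_by (cut a b u) t" if "ae_bounded_by u t" "0 < t" for a b u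
    using that by transfer (auto simp: indicator_def elim!: eventually_mono)
  then have "ae_bounded_by w t" using c assms by (simp add: w_def)
  have "(norm w)\<^sup>2 = inner c w" by (simp add: w_def inner_cut_right)
  also have "\<dots> = (\<integral>x. t * (indicator {0..<b} x * t) \<partial>unit_leb)"
    unfolding w_def c_def
    by (subst cut.abs_eq) (auto simp: inner_L2.abs_eq ae_eq_def square_int_const square_int_indicator_mult)
  also have "\<dots> = t\<^sup>2 * (\<integral>x. indicator {0..<b} x \<partial>unit_leb)"
    unfolding integral_mult_right_zero[symmetric]
    by (intro Bochner_Integration.integral_cong) (auto simp: power2_eq_square)
  also have "\<dots> = t\<^sup>2 * b" using b by (subst integral_indicator_interval) auto
  finally have nw: "(norm w)\<^sup>2 = t\<^sup>2 * b" .
  have "norm w \<le> \<epsilon>" by (rule power2_le_imp_le) (use b(3) nw assms in auto)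
  have "(norm (volterra w))\<^sup>2 \<le> (t * (b - 0))\<^sup>2"
    unfolding w_def using b by (intro power2_norm_volterra_cut_le c) auto
  also have "\<dots> = t\<^sup>2 * b * b" by (simp add: power2_eq_square)
  also have "\<dots> < 1 / 2 * (t\<^sup>2 * b)" using b assms by simp
  finally show ?thesis using \<open>ae_bounded_by w t\<close> \<open>norm w \<le> \<epsilon>\<close> nw by auto
qed

lemma no_local_minimizer_if_pos:
  assumes "0 < t"
  shows "\<not> local_minimizer_on (objective h) feasible (t, u)"
proof
  assume "local_minimizer_on (objective h) feasible (t, u)"
  then obtain \<epsilon> where \<epsilon>: "0 < \<epsilon>" and bd: "ae_bounded_by u t"
    and min: "\<And>p. p \<in> feasible \<Longrightarrow> norm (p - (t, u)) \<le> \<epsilon> \<Longrightarrow> objective h (t, u) \<le> objective h p"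
    unfolding local_minimizer_on_def by (auto simp: feasible_def)
  have min': "(norm (volterra u))\<^sup>2 - 1 / 2 * (norm u)\<^sup>2 \<le> (norm (volterra w))\<^sup>2 - 1 / 2 * (norm w)\<^sup>2"
    if "ae_bounded_by w t" "norm (w - u) \<le> \<epsilon>" for w
    using min[of "(t, w)"] that by (simp add: feasible_def objective_def norm_Pair)
  have "volterra u = 0"
    by (rule volterra_zero_if_flips_do_not_decrease[OF bd \<epsilon>]) (use min' in force)
  then have u: "u = 0" by (rule volterra_eq_0D)
  obtain w where "ae_bounded_by w t" "norm w \<le> \<epsilon>" "(norm (volterra w))\<^sup>2 < 1 / 2 * (norm w)\<^sup>2"
    using exists_small_decrease_at_zero[OF assms \<epsilon>] by blast
  then show False using min'[of w] \<open>volterra u = 0\<close> by (simp add: u)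
qed

lemma ae_bounded_by_zero: "0 \<le> t \<Longrightarrow> ae_bounded_by 0 t"
  by transfer simp

lemma volterra_0: "volterra 0 = 0"
  using volterra_scaleR[of 0 0] by simp

lemma objective_ge:
  assumes "(t, u) \<in> feasible"
  shows "(t\<^sup>2 + (norm u)\<^sup>2) / 4 \<le> objective 0 (t, u)"
proof -
  have "norm u \<le> t" using assms norm_le_bound by (simp add: feasible_def)
  then have "0 \<le> t\<^sup>2 - (norm u)\<^sup>2" by (simp add: power_mono)
  moreover have "objective 0 (t, u) = (t\<^sup>2 + (norm u)\<^sup>2) / 4
      + (3 / 4 * (t\<^sup>2 - (norm u)\<^sup>2) + (norm (volterra u))\<^sup>2)"
    by (simp add: objective_def field_simps)
  ultimately show ?thesis by simp
qed

lemma local_minimizer_zero: "local_minimizer_on (objective 0) feasible (0, 0)"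
  unfolding local_minimizer_on_def
proof (intro conjI exI[of _ 1] ballI impI)
  show "(0, 0) \<in> feasible" by (simp add: feasible_def ae_bounded_by_zero)
next
  fix y assume "y \<in> feasible"
  moreover obtain t u where "y = (t, u)" by (cases y)
  ultimately have "(t\<^sup>2 + (norm u)\<^sup>2) / 4 \<le> objective 0 y" using objective_ge by blast
  moreover have "0 \<le> (t\<^sup>2 + (norm u)\<^sup>2) / 4" by simp
  moreover have "objective 0 (0, 0) = 0" by (simp add: objective_def volterra_0)
  ultimately show "objective 0 (0, 0) \<le> objective 0 y" by linarith
qed simp

section \<open>Derivatives and the tangent cone\<close>

lemma fderiv_objective:
  "blinfun_apply (fderiv (objective h) p) d = 2 * fst p * fst d
     + 2 * inner (volterra (snd p)) (volterra (snd d)) - inner (snd p) (snd d) - h * fst d"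
proof -
  note D = has_derivative_objective[of h p]
  note B = bounded_linear_Blinfun_apply[OF has_derivative_bounded_linear[OF D]]
  have "fderiv (objective h) p = Blinfun (\<lambda>d. 2 * fst p * fst d
     + 2 * inner (volterra (snd p)) (volterra (snd d)) - inner (snd p) (snd d) - h * fst d)"
    by (rule fderiv_eqI) (simp add: B D)
  then show ?thesis by (simp add: B)
qed

text \<open>The derivative of \<open>q \<mapsto> f'(q) d\<close> is computed twice: once from the explicit formula for
  \<open>f'(q) d\<close>, and once from the derivative of \<open>f'\<close> followed by evaluation at \<open>d\<close>.\<close>

lemma fderiv_fderiv_objective:
  "blinfun_apply (blinfun_apply (fderiv (fderiv (objective h)) p) d) d = 2 * objective 0 d"
proof -
  have "fderiv (objective h) differentiable (at p)"
    using twice_cont_frechet_diff_objective[of h]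
    unfolding twice_cont_frechet_diff_def by blast
  then obtain D' where D': "(fderiv (objective h) has_derivative D') (at p)"
    by (auto simp: differentiable_def)
  note B = bounded_linear_Blinfun_apply[OF has_derivative_bounded_linear[OF D']]
  have eq: "blinfun_apply (fderiv (fderiv (objective h)) p) = D'"
    using fderiv_eqI[of "fderiv (objective h)" "Blinfun D'" p] D' by (simp add: B)
  have 1: "((\<lambda>q. blinfun_apply (fderiv (objective h) q) d) has_derivative
      (\<lambda>e. blinfun_apply (D' e) d)) (at p)"
    by (rule bounded_linear.has_derivative[OF blinfun.bounded_linear_left D'])
  note [derivative_intros] = bounded_linear.has_derivative[OF bounded_linear_volterra]
  have 2: "((\<lambda>q. blinfun_apply (fderiv (objective h) q) d) has_derivative
      (\<lambda>e. 2 * fst e * fst d + 2 * inner (volterra (snd e)) (volterra (snd d))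
        - inner (snd e) (snd d))) (at p)"
    unfolding fderiv_objective by (auto intro!: derivative_eq_intros)
  have "blinfun_apply (D' d) d = 2 * fst d * fst d
      + 2 * inner (volterra (snd d)) (volterra (snd d)) - inner (snd d) (snd d)"
    using fun_cong[OF has_derivative_unique[OF 1 2], of d] .
  also have "\<dots> = 2 * objective 0 d"
    unfolding objective_def power2_norm_eq_inner
    by (simp add: case_prod_unfold power2_eq_square)
  finally show ?thesis by (simp only: eq)
qed

lemma tangent_cone_feasible: "tangent_cone feasible (0, 0) \<subseteq> feasible"
  unfolding tangent_cone_def
proof (rule closure_minimal[OF _ closed_feasible])
  have "ae_bounded_by (r *\<^sub>R u) (r * t)" if "0 \<le> r" "ae_bounded_by u t" for r t u
    using that
    by transfer (auto simp: abs_mult intro!: mult_left_mono elim!: eventually_mono)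
  then show "{r *\<^sub>R (y - (0, 0)) |r y. y \<in> feasible \<and> 0 \<le> r} \<subseteq> feasible"
    by (auto simp: feasible_def)
qed

lemma second_order_sufficient_objective: "second_order_sufficient (objective 0) feasible (0, 0)"
  unfolding second_order_sufficient_def
proof (intro conjI exI[of _ "1/2"] ballI)
  show "- fderiv (objective 0) (0, 0) \<in> normal_cone feasible (0, 0)"
    by (simp add: normal_cone_def blinfun.minus_left fderiv_objective volterra_0)
next
  fix d assume "d \<in> approx_critical_cone (objective 0) feasible (1/2) (0, 0)"
  then have "d \<in> feasible"
    using tangent_cone_feasible by (auto simp: approx_critical_cone_def)
  moreover obtain t u where d: "d = (t, u)" by (cases d)
  ultimately have "(norm d)\<^sup>2 / 4 \<le> objective 0 d"
    using objective_ge[of t u] by (simp add: norm_Pair)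
  then show "1 / 2 * (norm d)\<^sup>2
      \<le> blinfun_apply (blinfun_apply (fderiv (fderiv (objective 0)) (0, 0)) d) d"
    unfolding fderiv_fderiv_objective by simp
qed auto

theorem mainTheorem1:
  shows "((\<forall>p. local_minimizer_on (objective 0) feasible p \<longleftrightarrow> p = (0, 0)) \<and>
          second_order_sufficient (objective 0) feasible (0, 0)) \<and>
         (\<forall>h>0. \<not> (\<exists>p. local_minimizer_on (objective h) feasible p))"
proof -
  have zero: "p = (0, 0)" if "local_minimizer_on (objective h) feasible p" for h p
  proof -
    obtain t u where p: "p = (t, u)" by (cases p)
    have bd: "ae_bounded_by u t"
      using that by (simp add: local_minimizer_on_def feasible_def p)
    have "\<not> 0 < t" using no_local_minimizer_if_pos that p by blast
    then have "t = 0" using ae_bounded_by_nonneg[OF bd] by simp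
    then show ?thesis using norm_le_bound[OF bd] by (simp add: p)
  qed
  have "\<not> local_minimizer_on (objective h) feasible (0, 0)" if h: "0 < h" for h
  proof
    assume "local_minimizer_on (objective h) feasible (0, 0)"
    then obtain \<epsilon> where \<epsilon>: "0 < \<epsilon>"
      and min: "\<And>p. p \<in> feasible \<Longrightarrow> norm (p - (0, 0)) \<le> \<epsilon> \<Longrightarrow>
        objective h (0, 0) \<le> objective h p"
      unfolding local_minimizer_on_def by blast
    define s where "s = min \<epsilon> (h / 2)"
    have s: "0 < s" "s \<le> \<epsilon>" "s < h" using \<epsilon> h by (auto simp: s_def min_def)
    have "objective h (0, 0) \<le> objective h (s, 0)"
      using s by (intro min) (auto simp: feasible_def ae_bounded_by_zero norm_Pair)
    then have "h * s \<le> s * s" by (simp add: objective_def volterra_0 power2_eq_square)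
    with s show False by simp
  qed
  with zero show ?thesis
    using local_minimizer_zero second_order_sufficient_objective by blast
qed

end
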